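(* A Tychonoff space $X$ is universally $R$-measure zero (i.e. $M_R(X)=M_d(X)$) if and only if every compact subset of $X$ is scattered.
   Context: $\beta X$ is the Stone–Čech compactification, and $M(\beta X)$ is the set of finite signed regular Borel measures on $\beta X$; $|\mu|$ is the total variation. $M_R(X)$ is the set of $\mu\in M(\beta X)$ concentrated on some $\sigma$-compact subset of $X$, and $M_d(X)$ is the set of $\mu\in M(\beta X)$ concentrated on some countable subset of $X$, where "$\mu$ is concentrated on $S$" means $|\mu|(\beta X\setminus S)=0$. A space is scattered if each of its nonempty subspaces has an isolated point. *)

theory Defs
  imports "HOL-Analysis.Analysis"
begin

section \<open>The Stone--Cech compactification\<close>

text \<open>
  The compactification is realised as the closure of the image of the evaluation map in the
  cube $[0,1]^{C(X,[0,1])}$. The index functions are taken extensional, so that each continuous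
  function on the carrier \<^term>\<open>topspace X\<close> contributes exactly one coordinate.
\<close>

definition unit_functions :: "'a topology \<Rightarrow> ('a \<Rightarrow> real) set" where
  "unit_functions X =
     {f \<in> extensional (topspace X). continuous_map X (top_of_set {0..1}) f}"

definition unit_cube :: "'a topology \<Rightarrow> (('a \<Rightarrow> real) \<Rightarrow> real) topology" where
  "unit_cube X = product_topology (\<lambda>f. top_of_set {0..1}) (unit_functions X)"

definition stone_cech_embed :: "'a topology \<Rightarrow> 'a \<Rightarrow> ('a \<Rightarrow> real) \<Rightarrow> real" where
  "stone_cech_embed X x = (\<lambda>f\<in>unit_functions X. f x)"

definition stone_cech :: "'a topology \<Rightarrow> (('a \<Rightarrow> real) \<Rightarrow> real) topology" where
  "stone_cech X =
     subtopology (unit_cube X) (unit_cube X closure_of (stone_cech_embed X ` topspace X))"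

lemma topspace_stone_cech:
  "topspace (stone_cech X) = unit_cube X closure_of (stone_cech_embed X ` topspace X)"
  by (simp add: stone_cech_def closure_of_subset_topspace inf.absorb2)

lemma compact_space_unit_cube: "compact_space (unit_cube X)"
  unfolding unit_cube_def
  using compact_space_product_topology compact_space_subtopology compactin_euclidean_iff by blast

lemma Hausdorff_space_unit_cube: "Hausdorff_space (unit_cube X)"
  unfolding unit_cube_def
  using Hausdorff_space_euclidean Hausdorff_space_product_topology Hausdorff_space_subtopology
  by blast

lemma compact_space_stone_cech: "compact_space (stone_cech X)"
  unfolding stone_cech_def
  by (simp add: closedin_compact_space compact_space_subtopology compact_space_unit_cube)

lemma Hausdorff_space_stone_cech: "Hausdorff_space (stone_cech X)"
  unfolding stone_cech_def by (simp add: Hausdorff_space_subtopology Hausdorff_space_unit_cube)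

lemma unit_functions_eq_mspace:
  "unit_functions X =
     mspace (submetric (cfunspace X euclidean_metric) {f. f \<in> topspace X \<rightarrow> {0..1}})"
proof -
  have "bounded (f ` topspace X)" if "f \<in> topspace X \<rightarrow> {0..1::real}" for f
    using that by (metis bounded_closed_interval bounded_subset image_subset_iff_funcset)
  then show ?thesis
    by (auto simp: unit_functions_def continuous_map_in_subtopology)
qed

lemma stone_cech_embed_in:
  assumes "x \<in> topspace X"
  shows "stone_cech_embed X x \<in> topspace (unit_cube X)"
  using assms
  by (auto simp: stone_cech_embed_def unit_cube_def unit_functions_def
      continuous_map_in_subtopology image_subset_iff)

lemma stone_cech_embed_image_subset:
  "stone_cech_embed X ` topspace X \<subseteq> topspace (stone_cech X)"
  unfolding topspace_stone_cech by (rule closure_of_subset) (auto simp: stone_cech_embed_in)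

lemma embedding_map_stone_cech:
  assumes "completely_regular_space X" "Hausdorff_space X"
  shows "embedding_map X (stone_cech X) (stone_cech_embed X)"
proof -
  have "embedding_map X (unit_cube X) (stone_cech_embed X)"
    using completely_regular_space_cube_embedding_explicit[OF assms]
    by (simp only: unit_cube_def stone_cech_embed_def[abs_def] unit_functions_eq_mspace)
  then show ?thesis
    unfolding stone_cech_def
    using stone_cech_embed_image_subset[of X]
    by (simp add: embedding_map_in_subtopology topspace_stone_cech)
qed

lemma stone_cech_dense:
  "stone_cech X closure_of (stone_cech_embed X ` topspace X) = topspace (stone_cech X)"
  using stone_cech_embed_image_subset[of X]
  by (simp add: stone_cech_def closure_of_subtopology inf.absorb2 topspace_stone_cech
      closure_of_subset_topspace)

lemma stone_cech_extension:
  assumes "continuous_map X (top_of_set {0..1::real}) f"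
  obtains g where "continuous_map (stone_cech X) (top_of_set {0..1}) g"
    and "\<And>x. x \<in> topspace X \<Longrightarrow> g (stone_cech_embed X x) = f x"
proof -
  have r: "restrict f (topspace X) \<in> unit_functions X"
    using continuous_map_eq[OF assms, of "restrict f (topspace X)"]
    by (auto simp: unit_functions_def)
  show ?thesis
  proof
    show "continuous_map (stone_cech X) (top_of_set {0..1}) (\<lambda>p. p (restrict f (topspace X)))"
      unfolding stone_cech_def unit_cube_def
      by (intro continuous_map_from_subtopology continuous_map_product_projection r)
    show "stone_cech_embed X x (restrict f (topspace X)) = f x" if "x \<in> topspace X" for x
      using that r by (simp add: stone_cech_embed_def)
  qed
qed

section \<open>Finite signed regular Borel measures\<close>

definition borel_of :: "'a topology \<Rightarrow> 'a measure" where
  "borel_of X = sigma (topspace X) {U. openin X U}"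

lemma space_borel_of [simp]: "space (borel_of X) = topspace X"
  by (simp add: borel_of_def space_measure_of_conv)

lemma sets_borel_of: "sets (borel_of X) = sigma_sets (topspace X) {U. openin X U}"
  unfolding borel_of_def by (rule sets_measure_of) (auto dest: openin_subset)

text \<open>
  Signed measures are real-valued set functions; only the \<open>\<sigma>\<close>-algebra of \<open>M\<close> is
  used. They are normalised to be \<open>0\<close> off that \<open>\<sigma>\<close>-algebra, so that equality of signed
  measures is equality of functions.
\<close>

definition finite_signed_measure :: "'a measure \<Rightarrow> ('a set \<Rightarrow> real) \<Rightarrow> bool" where
  "finite_signed_measure M \<mu> \<longleftrightarrow>
     (\<forall>A. range A \<subseteq> sets M \<longrightarrow> disjoint_family A \<longrightarrow>
        (\<lambda>i::nat. \<mu> (A i)) sums \<mu> (\<Union>i. A i)) \<and>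
     (\<forall>A. A \<notin> sets M \<longrightarrow> \<mu> A = 0)"

definition total_variation :: "'a measure \<Rightarrow> ('a set \<Rightarrow> real) \<Rightarrow> 'a set \<Rightarrow> ennreal" where
  "total_variation M \<mu> A =
     (SUP P \<in> {P. finite P \<and> P \<subseteq> sets M \<and> disjoint P \<and> \<Union>P = A}.
        \<Sum>B\<in>P. ennreal \<bar>\<mu> B\<bar>)"

definition regular_signed_measure :: "'a topology \<Rightarrow> ('a set \<Rightarrow> real) \<Rightarrow> bool" where
  "regular_signed_measure Y \<mu> \<longleftrightarrow>
     (\<forall>A \<in> sets (borel_of Y).
        total_variation (borel_of Y) \<mu> A =
          (SUP K \<in> {K. compactin Y K \<and> K \<subseteq> A}. total_variation (borel_of Y) \<mu> K) \<and>
        total_variation (borel_of Y) \<mu> A =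
          (INF U \<in> {U. openin Y U \<and> A \<subseteq> U}. total_variation (borel_of Y) \<mu> U))"

definition regular_borel_measures :: "'a topology \<Rightarrow> ('a set \<Rightarrow> real) set" where
  "regular_borel_measures Y =
     {\<mu>. finite_signed_measure (borel_of Y) \<mu> \<and> regular_signed_measure Y \<mu>}"

text \<open>
  Below, \<open>S\<close> is always \<open>\<sigma>\<close>-compact or countable, hence Borel in the Hausdorff space \<open>Y\<close>, so
  \<^const>\<open>total_variation\<close> is evaluated at a Borel set.
\<close>

definition concentrated_on :: "'a topology \<Rightarrow> ('a set \<Rightarrow> real) \<Rightarrow> 'a set \<Rightarrow> bool" where
  "concentrated_on Y \<mu> S \<longleftrightarrow> total_variation (borel_of Y) \<mu> (topspace Y - S) = 0"

definition M_R :: "'a topology \<Rightarrow> ((('a \<Rightarrow> real) \<Rightarrow> real) set \<Rightarrow> real) set" where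
  "M_R X =
     {\<mu> \<in> regular_borel_measures (stone_cech X).
        \<exists>S. (countable union_of compactin X) S \<and>
            concentrated_on (stone_cech X) \<mu> (stone_cech_embed X ` S)}"

definition M_d :: "'a topology \<Rightarrow> ((('a \<Rightarrow> real) \<Rightarrow> real) set \<Rightarrow> real) set" where
  "M_d X =
     {\<mu> \<in> regular_borel_measures (stone_cech X).
        \<exists>S \<subseteq> topspace X. countable S \<and>
            concentrated_on (stone_cech X) \<mu> (stone_cech_embed X ` S)}"

definition universally_R_measure_zero :: "'a topology \<Rightarrow> bool" where
  "universally_R_measure_zero X \<longleftrightarrow> M_R X = M_d X"

section \<open>Scattered spaces\<close>

definition scattered_space :: "'a topology \<Rightarrow> bool" where
  "scattered_space X \<longleftrightarrow>
     (\<forall>S \<subseteq> topspace X. S \<noteq> {} \<longrightarrow> (\<exists>x\<in>S. openin (subtopology X S) {x}))"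

end

theory Submission
  imports Defs
begin

text \<open>
  If every compact subset of \<open>X\<close> is scattered and \<open>\<mu>\<close> is concentrated on a \<open>\<sigma>\<close>-compact set, then
  \<open>\<mu>\<close> lives on its atoms: a compact non-null subset of \<open>K\<close> avoiding the atoms would have a nonempty
  support, and an isolated point of that support would be an atom.

  Conversely, a compact set that is not scattered contains a set \<open>S\<close> without isolated points, in
  which a binary tree of open sets with disjoint closures can be grown. By compactness of the space
  of \<open>[0,1]\<close>-valued set functions there is a finitely additive probability on all subsets giving
  the \<open>2\<^sup>n\<close> nodes of level \<open>n\<close> equal mass. Regularising it by
  inner approximation with closed sets and then outer approximation with open sets yields a regular
  Borel measure, and the tree structure makes it diffuse.
\<close>

section \<open>From finitely additive charges to regular Borel measures\<close>

text \<open>The positive counterpart of \<open>regular_signed_measure\<close>, with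
  \<open>emeasure\<close> in place of the total variation. The two notions are matched in
  \<open>measure_regular_borel_measure\<close>.\<close>

definition regular_measure :: "'a topology \<Rightarrow> 'a measure \<Rightarrow> bool" where
  "regular_measure Y M \<longleftrightarrow>
     (\<forall>A \<in> sets M.
        emeasure M A = (SUP K \<in> {K. compactin Y K \<and> K \<subseteq> A}. emeasure M K) \<and>
        emeasure M A = (INF U \<in> {U. openin Y U \<and> A \<subseteq> U}. emeasure M U))"

lemma openin_sets_borel_of: "openin Y U \<Longrightarrow> U \<in> sets (borel_of Y)"
  by (simp add: sets_borel_of)

lemma closedin_sets_borel_of:
  assumes "closedin Y C"
  shows "C \<in> sets (borel_of Y)"
proof -
  have "topspace Y - (topspace Y - C) \<in> sets (borel_of Y)"
    using assms openin_sets_borel_of[of Y "topspace Y - C"]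
    by (metis openin_diff openin_topspace sets.compl_sets space_borel_of)
  then show ?thesis
    using assms closedin_subset double_diff by fastforce
qed

text \<open>A charge on all subsets is only finitely additive, which makes it obtainable as a
  pointwise limit of averages over finitely many points. The measure built from it below sees only
  its values on closed sets.\<close>

locale compact_Hausdorff_charge =
  fixes Y :: "'a topology" and m :: "'a set \<Rightarrow> real"
  assumes compact: "compact_space Y" and Hausdorff: "Hausdorff_space Y"
    and nonneg: "0 \<le> m A"
    and additive: "A \<inter> B = {} \<Longrightarrow> m (A \<union> B) = m A + m B"
begin

lemma charge_empty: "m {} = 0"
  using additive[of "{}" "{}"] by simp

lemma charge_mono:
  assumes "A \<subseteq> B" shows "m A \<le> m B"
proof -
  have "m B = m A + m (B - A)"
    using additive[of A "B - A"] assms by (metis Diff_disjoint Diff_partition)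
  then show ?thesis
    using nonneg[of "B - A"] by simp
qed

lemma charge_Un_le: "m (A \<union> B) \<le> m A + m B"
proof -
  have "m (A \<union> B) = m A + m (B - A)"
    using additive[of A "B - A"] by (simp add: Un_Diff_cancel)
  then show ?thesis
    using charge_mono[of "B - A" B] by simp
qed

lemma normal: "normal_space Y"
  using compact Hausdorff compact_Hausdorff_or_regular_imp_normal_space by blast

text \<open>\<open>m\<close> may fail countable subadditivity on open sets. Approximating from
  within by closed sets, which are compact here, repairs this, since open covers then reduce to
  finite ones.\<close>

definition inner :: "'a set \<Rightarrow> ennreal" where
  "inner U = (SUP C \<in> {C. closedin Y C \<and> C \<subseteq> U}. ennreal (m C))"

definition outer :: "'a set \<Rightarrow> ennreal" where
  "outer A = (INF U \<in> {U. openin Y U \<and> A \<subseteq> U}. inner U)"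

lemma charge_le_inner: "closedin Y C \<Longrightarrow> C \<subseteq> U \<Longrightarrow> ennreal (m C) \<le> inner U"
  unfolding inner_def by (rule SUP_upper) auto

lemma inner_mono: "U \<subseteq> V \<Longrightarrow> inner U \<le> inner V"
  unfolding inner_def by (rule SUP_subset_mono) auto

lemma inner_le_charge: "inner U \<le> ennreal (m U)"
  unfolding inner_def by (rule SUP_least) (auto intro!: ennreal_leI charge_mono)

lemma outer_le_inner: "openin Y U \<Longrightarrow> A \<subseteq> U \<Longrightarrow> outer A \<le> inner U"
  unfolding outer_def by (rule INF_lower) auto

lemma outer_openin: "openin Y U \<Longrightarrow> outer U = inner U"
  unfolding outer_def by (intro antisym INF_lower INF_greatest) (auto intro: inner_mono)

lemma outer_mono: "A \<subseteq> B \<Longrightarrow> outer A \<le> outer B"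
  unfolding outer_def by (rule INF_superset_mono) auto

lemma outer_empty: "outer {} = 0"
  using inner_le_charge[of "{}"] outer_openin[of "{}"] by (simp add: charge_empty)

lemma outer_le_space: "A \<subseteq> topspace Y \<Longrightarrow> outer A \<le> ennreal (m (topspace Y))"
  using outer_le_inner[of "topspace Y" A] inner_le_charge[of "topspace Y"] by simp

text \<open>Normality lets a closed subset of a union of two open sets be split into closed parts.\<close>

lemma charge_le_sum_inner:
  assumes "finite I" "closedin Y C" "C \<subseteq> (\<Union>i\<in>I. U i)" "\<And>i. i \<in> I \<Longrightarrow> openin Y (U i)"
  shows "ennreal (m C) \<le> (\<Sum>i\<in>I. inner (U i))"
  using assms
proof (induction I arbitrary: C rule: finite_induct)
  case empty
  then show ?case by (simp add: charge_empty)
next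
  case (insert a I)
  let ?V = "\<Union>i\<in>I. U i"
  have V: "openin Y ?V" and Ua: "openin Y (U a)"
    using insert.prems by auto
  have "closedin Y (C - ?V)" "closedin Y (C - U a)" "disjnt (C - ?V) (C - U a)"
    using V Ua insert.prems by (auto intro: closedin_diff simp: disjnt_iff)
  then obtain G where G: "openin Y G" "C - ?V \<subseteq> G" "disjnt (C - U a) (Y closure_of G)"
    using normal unfolding normal_space by meson
  \<comment> \<open>\<open>C\<close> meets the closure of \<open>G\<close> only inside
    \<open>U a\<close>, and \<open>C - G\<close> lies in \<open>?V\<close>. The two pieces may
    overlap, so \<open>m\<close> is merely subadditive on them.\<close>
  have 1: "closedin Y (C \<inter> (Y closure_of G))"
    using insert.prems by auto
  have 2: "closedin Y (C - G)"
    using insert.prems G by (auto intro: closedin_diff)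
  have "G \<subseteq> Y closure_of G"
    by (rule closure_of_subset[OF openin_subset[OF G(1)]])
  then have "m C \<le> m (C \<inter> (Y closure_of G)) + m (C - G)"
    by (intro order_trans[OF charge_mono charge_Un_le]) auto
  then have "ennreal (m C) \<le> ennreal (m (C \<inter> (Y closure_of G))) + ennreal (m (C - G))"
    by (metis ennreal_leI ennreal_plus nonneg)
  also have "\<dots> \<le> inner (U a) + (\<Sum>i\<in>I. inner (U i))"
  proof (rule add_mono)
    show "ennreal (m (C \<inter> (Y closure_of G))) \<le> inner (U a)"
      using G by (intro charge_le_inner 1) (auto simp: disjnt_iff)
    show "ennreal (m (C - G)) \<le> (\<Sum>i\<in>I. inner (U i))"
      using G insert.prems by (intro insert.IH 2) auto
  qed
  finally show ?case
    using insert.hyps by simp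
qed

text \<open>Compactness of each closed set below the union replaces the sequence by a finite
  subfamily. This is where countable subadditivity arises from finite additivity.\<close>

lemma inner_UN_le:
  fixes U :: "nat \<Rightarrow> 'a set"
  assumes "\<And>i. openin Y (U i)"
  shows "inner (\<Union>i. U i) \<le> (\<Sum>i. inner (U i))"
  unfolding inner_def[of "\<Union>i. U i"]
proof (rule SUP_least, clarify)
  fix C assume C: "closedin Y C" "C \<subseteq> (\<Union>i. U i)"
  have "compactin Y C"
    using C compact closedin_compact_space by blast
  then obtain \<F> where "finite \<F>" "\<F> \<subseteq> range U" "C \<subseteq> \<Union>\<F>"
    using C assms compactinD[of Y C "range U"] by auto
  then obtain I where I: "finite I" "C \<subseteq> (\<Union>i\<in>I. U i)"
    by (metis finite_subset_image)
  then have "ennreal (m C) \<le> (\<Sum>i\<in>I. inner (U i))"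
    using C assms by (intro charge_le_sum_inner) auto
  also have "\<dots> \<le> (\<Sum>i. inner (U i))"
    by (rule sum_le_suminf) (use I in auto)
  finally show "ennreal (m C) \<le> (\<Sum>i. inner (U i))" .
qed

lemma outer_UN_le:
  fixes A :: "nat \<Rightarrow> 'a set"
  assumes A: "\<And>i. A i \<subseteq> topspace Y"
  shows "outer (\<Union>i. A i) \<le> (\<Sum>i. outer (A i))"
proof (rule ennreal_le_epsilon)
  fix e :: real assume e: "0 < e"
  \<comment> \<open>The outer values are bounded by the charge of the whole space, hence finite, so
    open supersets can be chosen with errors that sum to \<open>e\<close>.\<close>
  have "\<exists>U. openin Y U \<and> A n \<subseteq> U \<and> inner U < outer (A n) + e * (1/2) ^ Suc n" for n
  proof -
    have "outer (A n) \<noteq> \<infinity>"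
      using outer_le_space[OF A, of n] by (auto simp: top_unique)
    then show ?thesis
      using INF_approx_ennreal[of "e * (1/2) ^ Suc n" "outer (A n)" inner "{U. openin Y U \<and> A n \<subseteq> U}"] e
      unfolding outer_def by auto
  qed
  then obtain U where U: "\<And>n. openin Y (U n)" "\<And>n. A n \<subseteq> U n"
    "\<And>n. inner (U n) < outer (A n) + e * (1/2) ^ Suc n"
    by metis
  have "outer (\<Union>i. A i) \<le> inner (\<Union>i. U i)"
    using U by (intro outer_le_inner) auto
  also have "\<dots> \<le> (\<Sum>i. inner (U i))"
    using U by (intro inner_UN_le)
  also have "\<dots> \<le> (\<Sum>n. outer (A n) + e * (1/2) ^ Suc n)"
    by (intro suminf_le less_imp_le[OF U(3)]) auto
  also have "\<dots> = (\<Sum>n. outer (A n)) + (\<Sum>n. ennreal e * ennreal ((1/2) ^ Suc n))"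
    using e by (subst suminf_add[symmetric])
      (auto simp del: ennreal_suminf_cmult simp add: ennreal_mult[symmetric])
  also have "\<dots> = (\<Sum>n. outer (A n)) + e"
    unfolding ennreal_suminf_cmult
    by (subst suminf_ennreal_eq[OF zero_le_power power_half_series]) auto
  finally show "outer (\<Union>i. A i) \<le> (\<Sum>n. outer (A n)) + ennreal e" .
qed

lemma outer_measure_space_outer: "outer_measure_space (Pow (topspace Y)) outer"
  unfolding outer_measure_space_def positive_def increasing_def countably_subadditive_def
  using outer_empty outer_mono outer_UN_le by (simp add: image_subset_iff)

text \<open>The hard half of Caratheodory's condition, for open test sets. For closed
  \<open>C\<close> inside \<open>V\<close> and \<open>U\<close>, the set \<open>V - C\<close> is an
  open superset of \<open>V - U\<close>; any closed \<open>D\<close> inside it is disjoint from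
  \<open>C\<close>, so the union of \<open>C\<close> and \<open>D\<close> competes in the supremum
  for \<open>V\<close>.\<close>

lemma inner_superadditive:
  assumes U: "openin Y U" and V: "openin Y V"
  shows "inner (V \<inter> U) + outer (V - U) \<le> inner V"
proof -
  have "inner (V \<inter> U) + outer (V - U) =
      (SUP C \<in> {C. closedin Y C \<and> C \<subseteq> V \<inter> U}. ennreal (m C) + outer (V - U))"
    unfolding inner_def by (rule ennreal_SUP_add_left[symmetric]) (use closedin_empty in auto)
  also have "\<dots> \<le> inner V"
  proof (rule SUP_least, clarify)
    fix C assume C: "closedin Y C" "C \<subseteq> V \<inter> U"
    have "outer (V - U) \<le> inner (V - C)"
      using C V by (intro outer_le_inner) (auto intro: openin_diff)
    then have "ennreal (m C) + outer (V - U) \<le> ennreal (m C) + inner (V - C)"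
      by (rule add_left_mono)
    also have "\<dots> = (SUP D \<in> {D. closedin Y D \<and> D \<subseteq> V - C}. ennreal (m C) + ennreal (m D))"
      unfolding inner_def add.commute[of "ennreal (m C)"]
      by (rule ennreal_SUP_add_left[symmetric]) (use closedin_empty in auto)
    also have "\<dots> \<le> inner V"
    proof (rule SUP_least, clarify)
      fix D assume D: "closedin Y D" "D \<subseteq> V - C"
      have "C \<inter> D = {}"
        using D by auto
      then have "ennreal (m C) + ennreal (m D) = ennreal (m (C \<union> D))"
        using nonneg additive by (simp flip: ennreal_plus)
      also have "\<dots> \<le> inner V"
        using C D by (intro charge_le_inner) auto
      finally show "ennreal (m C) + ennreal (m D) \<le> inner V" .
    qed
    finally show "ennreal (m C) + outer (V - U) \<le> inner V" .
  qed
  finally show ?thesis .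
qed

text \<open>An arbitrary test set is reduced to an open one by passing to the infimum over its open
  supersets.\<close>

lemma openin_lambda_system:
  assumes U: "openin Y U"
  shows "U \<in> lambda_system (topspace Y) (Pow (topspace Y)) outer"
proof -
  interpret P: sigma_algebra "topspace Y" "Pow (topspace Y)"
    by (rule sigma_algebra_Pow)
  have "outer (A \<inter> U) + outer (A - U) = outer A" if A: "A \<subseteq> topspace Y" for A
  proof (rule antisym)
    have "outer ((A \<inter> U) \<union> (A - U)) \<le> outer (A \<inter> U) + outer (A - U)"
      using A outer_empty
      by (intro subadditiveD[OF P.countably_subadditive_subadditive[of outer]])
        (use outer_measure_space_outer in \<open>auto simp: outer_measure_space_def\<close>)
    then show "outer A \<le> outer (A \<inter> U) + outer (A - U)"
      by (simp add: Int_Diff_Un)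
    show "outer (A \<inter> U) + outer (A - U) \<le> outer A"
      unfolding outer_def[of A]
    proof (rule INF_greatest, clarify)
      fix V assume V: "openin Y V" "A \<subseteq> V"
      have "outer (A \<inter> U) + outer (A - U) \<le> inner (V \<inter> U) + outer (V - U)"
        using U V by (intro add_mono outer_le_inner outer_mono) auto
      also have "\<dots> \<le> inner V"
        using U V by (intro inner_superadditive)
      finally show "outer (A \<inter> U) + outer (A - U) \<le> inner V" .
    qed
  qed
  then show ?thesis
    using U openin_subset[of Y U] by (auto simp: P.lambda_system_eq)
qed

section \<open>The regular Borel measure induced by a charge\<close>

definition charge_measure :: "'a measure" where
  "charge_measure = measure_of (topspace Y) {U. openin Y U} outer"

lemma sets_charge_measure [simp]: "sets charge_measure = sets (borel_of Y)"
  unfolding charge_measure_def sets_borel_of by (rule sets_measure_of) (auto dest: openin_subset)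

lemma space_charge_measure [simp]: "space charge_measure = topspace Y"
  by (simp add: charge_measure_def space_measure_of_conv)

text \<open>\<open>measure_of\<close> returns \<open>outer\<close> only once \<open>outer\<close> is
  known to be a measure on the generated sigma-algebra. Caratheodory's theorem gives this on the
  lambda system, which contains the open sets and hence all Borel sets.\<close>

lemma emeasure_charge_measure:
  assumes "A \<in> sets (borel_of Y)"
  shows "emeasure charge_measure A = outer A"
proof -
  interpret P: sigma_algebra "topspace Y" "Pow (topspace Y)"
    by (rule sigma_algebra_Pow)
  have L: "measure_space (topspace Y) (lambda_system (topspace Y) (Pow (topspace Y)) outer) outer"
    using outer_measure_space_outer by (rule P.caratheodory_lemma)
  then have "sigma_sets (topspace Y) {U. openin Y U} \<subseteq>
      lambda_system (topspace Y) (Pow (topspace Y)) outer"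
    by (intro sigma_algebra.sigma_sets_subset)
      (auto simp: measure_space_def openin_lambda_system)
  then have "measure_space (topspace Y) (sigma_sets (topspace Y) {U. openin Y U}) outer"
    by (intro measure_down[OF L] sigma_algebra_sigma_sets) (auto dest: openin_subset)
  then show ?thesis
    using assms
    by (intro emeasure_measure_of[OF charge_measure_def])
      (auto simp: measure_space_def sets_borel_of dest: openin_subset)
qed

lemma finite_charge_measure: "finite_measure charge_measure"
proof
  have "emeasure charge_measure (space charge_measure) \<le> ennreal (m (topspace Y))"
    using inner_le_charge[of "topspace Y"]
    by (simp add: emeasure_charge_measure openin_sets_borel_of outer_openin)
  then show "emeasure charge_measure (space charge_measure) \<noteq> \<infinity>"
    by (auto simp: top_unique)
qed

text \<open>Mass can only drop on open sets. Through this bound, small or vanishing charge on open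
  sets passes to the measure.\<close>

lemma emeasure_charge_measure_open_le:
  "openin Y U \<Longrightarrow> emeasure charge_measure U \<le> ennreal (m U)"
  by (simp add: emeasure_charge_measure openin_sets_borel_of outer_openin inner_le_charge)

text \<open>The whole space is closed as well as open, so approximation from within loses none of
  its mass.\<close>

lemma emeasure_charge_measure_space:
  "emeasure charge_measure (topspace Y) = ennreal (m (topspace Y))"
  by (intro antisym emeasure_charge_measure_open_le)
    (simp_all add: emeasure_charge_measure openin_sets_borel_of outer_openin charge_le_inner)

lemma charge_measure_outer_regular:
  assumes "A \<in> sets (borel_of Y)"
  shows "emeasure charge_measure A =
    (INF U \<in> {U. openin Y U \<and> A \<subseteq> U}. emeasure charge_measure U)"
  unfolding emeasure_charge_measure[OF assms] outer_def[of A]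
  by (intro INF_cong)
    (auto simp: emeasure_charge_measure openin_sets_borel_of outer_openin)

lemma charge_measure_inner_regular:
  assumes A: "A \<in> sets (borel_of Y)"
  shows "emeasure charge_measure A =
    (SUP K \<in> {K. compactin Y K \<and> K \<subseteq> A}. emeasure charge_measure K)"
proof (rule antisym)
  interpret finite_measure charge_measure
    by (rule finite_charge_measure)
  have AY: "A \<subseteq> topspace Y"
    using sets.sets_into_space[OF A] by simp
  let ?B = "topspace Y - A"
  have B: "?B \<in> sets charge_measure"
    using A by (metis sets.compl_sets sets_charge_measure space_borel_of)
  let ?S = "SUP K \<in> {K. compactin Y K \<and> K \<subseteq> A}. emeasure charge_measure K"
  show "emeasure charge_measure A \<le> ?S"
  proof (rule ennreal_le_epsilon)
    fix e :: real assume e: "0 < e"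
    have "emeasure charge_measure ?B \<noteq> \<infinity>"
      by simp
    \<comment> \<open>Outer approximation of the complement \<open>?B\<close>. The complement of
      \<open>U\<close> is then a compact subset of \<open>A\<close>, and \<open>A\<close> exceeds it
      only by \<open>U - ?B\<close>, of measure at most \<open>e\<close>.\<close>
    then obtain U where U: "openin Y U" "?B \<subseteq> U"
      and le: "emeasure charge_measure U < emeasure charge_measure ?B + e"
      using INF_approx_ennreal[OF _ charge_measure_outer_regular[OF B[simplified]], of e] e
      by auto
    have U': "U \<in> sets charge_measure"
      using U openin_sets_borel_of by auto
    have K: "closedin Y (topspace Y - U)" 
      using U by auto
    have le': "emeasure charge_measure (U - ?B) \<le> ennreal e"
      using le e U U' B
      by (simp add: emeasure_eq_measure finite_measure_Diff ennreal_less_iff flip: ennreal_plus)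
    have "emeasure charge_measure A \<le>
        emeasure charge_measure ((topspace Y - U) \<union> (U - ?B))"
      using AY U' B closedin_sets_borel_of[OF K] by (intro emeasure_mono) auto
    also have "\<dots> \<le> emeasure charge_measure (topspace Y - U) + emeasure charge_measure (U - ?B)"
      using U' B closedin_sets_borel_of[OF K] by (intro emeasure_subadditive) auto
    also have "\<dots> \<le> ?S + ennreal e"
      using le' U K compact by (intro add_mono SUP_upper) (auto intro: closedin_compact_space)
    finally show "emeasure charge_measure A \<le> ?S + ennreal e" .
  qed
  show "?S \<le> emeasure charge_measure A"
    using A by (intro SUP_least emeasure_mono) auto
qed

lemma regular_charge_measure: "regular_measure Y charge_measure"
  using charge_measure_inner_regular charge_measure_outer_regular
  unfolding regular_measure_def by simp

end

section \<open>Signed measures on scattered sets\<close>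

lemma finite_signed_measure_empty:
  assumes "finite_signed_measure M \<mu>"
  shows "\<mu> {} = 0"
proof -
  have "(\<lambda>i::nat. \<mu> {}) sums \<mu> (\<Union>i::nat. {})"
    using assms unfolding finite_signed_measure_def
    by (elim conjE allE[of _ "\<lambda>i::nat. {}"]) (simp add: disjoint_family_on_def)
  then show ?thesis
    using summable_LIMSEQ_zero sums_summable LIMSEQ_const_iff by blast
qed

lemma finite_signed_measure_sums:
  assumes "finite_signed_measure M \<mu>" "range A \<subseteq> sets M" "disjoint_family A"
  shows "(\<lambda>i::nat. \<mu> (A i)) sums \<mu> (\<Union>i. A i)"
  using assms by (simp add: finite_signed_measure_def)

text \<open>A signed measure may vanish on a set by cancellation, so all measurable subsets are
  tested. On measurable sets this means variation zero, in a form to which countable additivity of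
  \<mu> applies directly.\<close>

definition signed_null :: "'a measure \<Rightarrow> ('a set \<Rightarrow> real) \<Rightarrow> 'a set \<Rightarrow> bool" where
  "signed_null M \<mu> A \<longleftrightarrow> (\<forall>B \<in> sets M. B \<subseteq> A \<longrightarrow> \<mu> B = 0)"

lemma total_variation_eq_0_iff:
  assumes A: "A \<in> sets M"
  shows "total_variation M \<mu> A = 0 \<longleftrightarrow> signed_null M \<mu> A"
proof
  assume "signed_null M \<mu> A"
  then have "(\<Sum>B\<in>P. ennreal \<bar>\<mu> B\<bar>) = 0" if "P \<subseteq> sets M" "\<Union>P = A" for P
    using that by (intro sum.neutral) (auto simp: signed_null_def)
  then show "total_variation M \<mu> A = 0"
    unfolding total_variation_def by (auto simp flip: bot_ennreal simp: SUP_bot_conv)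
next
  assume tv: "total_variation M \<mu> A = 0"
  show "signed_null M \<mu> A"
    unfolding signed_null_def
  proof (intro ballI impI)
    fix B assume B: "B \<in> sets M" "B \<subseteq> A"
    \<comment> \<open>A two-cell partition with \<open>B\<close> as a cell bounds its absolute value
      by the variation of \<open>A\<close>.\<close>
    have "(\<Sum>B\<in>{B, A - B}. ennreal \<bar>\<mu> B\<bar>) \<le> total_variation M \<mu> A"
      unfolding total_variation_def
      using A B by (intro SUP_upper) (auto simp: disjoint_def)
    moreover have "ennreal \<bar>\<mu> B\<bar> \<le> (\<Sum>B\<in>{B, A - B}. ennreal \<bar>\<mu> B\<bar>)"
      by (rule member_le_sum) auto
    ultimately show "\<mu> B = 0"
      using tv by simp
  qed
qed

lemma signed_null_subset: "signed_null M \<mu> A \<Longrightarrow> B \<subseteq> A \<Longrightarrow> signed_null M \<mu> B"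
  by (auto simp: signed_null_def)

text \<open>Disjointing the sequence makes countable additivity applicable, and each disjoint piece
  is still inside a null set.\<close>

lemma signed_null_UN:
  fixes A :: "nat \<Rightarrow> 'a set"
  assumes \<mu>: "finite_signed_measure M \<mu>"
    and A: "\<And>i. A i \<in> sets M" and null: "\<And>i. signed_null M \<mu> (A i)"
  shows "signed_null M \<mu> (\<Union>i. A i)"
  unfolding signed_null_def
proof (intro ballI impI)
  fix B assume B: "B \<in> sets M" "B \<subseteq> (\<Union>i. A i)"
  let ?D = "disjointed (\<lambda>i. B \<inter> A i)"
  have BA: "range (\<lambda>i. B \<inter> A i) \<subseteq> sets M"
    using A B by auto
  have "(\<lambda>i. \<mu> (?D i)) sums \<mu> (\<Union>i. ?D i)"
    by (intro finite_signed_measure_sums[OF \<mu>] sets.range_disjointed_sets[OF BA]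
        disjoint_family_disjointed)
  moreover have "(\<Union>i. ?D i) = B"
    using B by (auto simp: UN_disjointed_eq)
  moreover have "\<mu> (?D i) = 0" for i
    using null[of i] sets.range_disjointed_sets[OF BA] disjointed_subset[of "\<lambda>i. B \<inter> A i" i]
    by (auto simp: signed_null_def)
  ultimately show "\<mu> B = 0"
    using sums_unique2[OF _ sums_zero] by auto
qed

lemma signed_null_countable_Union:
  assumes \<mu>: "finite_signed_measure M \<mu>" and "countable \<A>"
    and "\<A> \<subseteq> sets M" "\<And>A. A \<in> \<A> \<Longrightarrow> signed_null M \<mu> A"
  shows "signed_null M \<mu> (\<Union>\<A>)"
proof (cases "\<A> = {}")
  case True
  then show ?thesis
    using finite_signed_measure_empty[OF \<mu>] by (auto simp: signed_null_def)
next
  case False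
  have "signed_null M \<mu> (\<Union>i. from_nat_into \<A> i)"
    using assms from_nat_into[OF False] by (intro signed_null_UN[OF \<mu>]) auto
  then show ?thesis
    using False assms(2) by (simp add: range_from_nat_into)
qed

lemma signed_null_Un:
  assumes "finite_signed_measure M \<mu>" "A \<in> sets M" "B \<in> sets M"
    "signed_null M \<mu> A" "signed_null M \<mu> B"
  shows "signed_null M \<mu> (A \<union> B)"
  using signed_null_countable_Union[of M \<mu> "{A, B}"] assms by auto

text \<open>Infinitely many atoms above a fixed size would give a sequence of disjoint singletons
  whose values are summable yet stay away from 0.\<close>

lemma countable_atoms:
  assumes \<mu>: "finite_signed_measure M \<mu>" and sing: "\<And>x. x \<in> space M \<Longrightarrow> {x} \<in> sets M"
  shows "countable {x. \<mu> {x} \<noteq> 0}"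
proof -
  have fin: "finite {x. 1 / Suc n < \<bar>\<mu> {x}\<bar>}" for n
  proof (rule ccontr)
    assume "infinite {x. 1 / Suc n < \<bar>\<mu> {x}\<bar>}"
    then obtain f :: "nat \<Rightarrow> 'a" where f: "inj f" "range f \<subseteq> {x. 1 / Suc n < \<bar>\<mu> {x}\<bar>}"
      using infinite_countable_subset by blast
    \<comment> \<open>A nonzero value forces measurability, because \<mu> is normalised to 0 off the
      sigma-algebra.\<close>
    have "\<mu> {f i} \<noteq> 0" for i
      using f(2) by (auto simp: field_simps dest!: subsetD[of _ _ "f i"])
    then have "{f i} \<in> sets M" for i
      using \<mu> unfolding finite_signed_measure_def by metis
    then have "(\<lambda>i. \<mu> {f i}) sums \<mu> (\<Union>i. {f i})"
      using f(1) by (intro finite_signed_measure_sums[OF \<mu>])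
        (auto simp: disjoint_family_on_def dest: injD)
    then have "(\<lambda>i. \<mu> {f i}) \<longlonglongrightarrow> 0"
      using sums_summable summable_LIMSEQ_zero by blast
    then have "eventually (\<lambda>i. \<bar>\<mu> {f i}\<bar> < 1 / Suc n) sequentially"
      using tendstoD[of "\<lambda>i. \<mu> {f i}" 0 sequentially "1 / Suc n"] by simp
    then obtain i where "\<bar>\<mu> {f i}\<bar> < 1 / Suc n"
      by (auto simp: eventually_sequentially)
    moreover have "1 / Suc n < \<bar>\<mu> {f i}\<bar>"
      using f(2) by auto
    ultimately show False by simp
  qed
  have "{x. \<mu> {x} \<noteq> 0} \<subseteq> (\<Union>n. {x. 1 / Suc n < \<bar>\<mu> {x}\<bar>})"
    using reals_Archimedean[of "\<bar>\<mu> {_}\<bar>"] by (auto simp: inverse_eq_divide)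
  moreover have "countable (\<Union>n. {x. 1 / Suc n < \<bar>\<mu> {x}\<bar>})"
    using fin by (auto intro: countable_finite)
  ultimately show ?thesis
    using countable_subset by blast
qed

text \<open>By inner regularity the variation of \<open>A\<close> is a supremum over compact
  subsets, which would be 0 if all of them were null.\<close>

lemma regular_signed_measure_not_null:
  assumes reg: "regular_signed_measure Y \<mu>" and Y: "Hausdorff_space Y"
    and A: "A \<in> sets (borel_of Y)" and nn: "\<not> signed_null (borel_of Y) \<mu> A"
  obtains K where "compactin Y K" "K \<subseteq> A" "\<not> signed_null (borel_of Y) \<mu> K"
proof -
  have "\<exists>K. compactin Y K \<and> K \<subseteq> A \<and> \<not> signed_null (borel_of Y) \<mu> K"
  proof (rule ccontr)
    assume no: "\<not> ?thesis"
    have "total_variation (borel_of Y) \<mu> K = 0" if "compactin Y K" "K \<subseteq> A" for K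
      using that no total_variation_eq_0_iff[OF closedin_sets_borel_of[OF compactin_imp_closedin[OF Y]]]
      by metis
    then have "(SUP K \<in> {K. compactin Y K \<and> K \<subseteq> A}. total_variation (borel_of Y) \<mu> K) = 0"
      by (auto simp flip: bot_ennreal simp: SUP_bot_conv)
    then have "total_variation (borel_of Y) \<mu> A = 0"
      using reg A by (simp add: regular_signed_measure_def)
    then show False
      using nn total_variation_eq_0_iff[OF A] by blast
  qed
  then show ?thesis
    using that by metis
qed

text \<open>Nullity is local on compact sets, by a finite subcover. The ambient set \<open>L\<close>
  is separate from \<open>K\<close> so that one support, taken relative to \<open>L\<close>, serves
  for many compact subsets.\<close>

lemma compactin_signed_nullI:
  assumes \<mu>: "finite_signed_measure (borel_of Y) \<mu>" and K: "compactin Y K"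
    and loc: "\<And>x. x \<in> K \<Longrightarrow> \<exists>U. openin Y U \<and> x \<in> U \<and> signed_null (borel_of Y) \<mu> (U \<inter> L)"
    and "K \<subseteq> L" and L: "L \<in> sets (borel_of Y)"
  shows "signed_null (borel_of Y) \<mu> K"
proof -
  obtain U where U: "\<And>x. x \<in> K \<Longrightarrow> openin Y (U x)" "\<And>x. x \<in> K \<Longrightarrow> x \<in> U x"
    "\<And>x. x \<in> K \<Longrightarrow> signed_null (borel_of Y) \<mu> (U x \<inter> L)"
    using loc by metis
  have "K \<subseteq> \<Union>(U ` K)"
    using U by auto
  then obtain \<F> where "finite \<F>" "\<F> \<subseteq> U ` K" "K \<subseteq> \<Union>\<F>"
    using compactinD[OF K, of "U ` K"] U by (metis imageE)
  then obtain I where I: "finite I" "I \<subseteq> K" "K \<subseteq> (\<Union>x\<in>I. U x)"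
    by (metis finite_subset_image)
  have "signed_null (borel_of Y) \<mu> (\<Union>x\<in>I. U x \<inter> L)"
    using I U L
    by (intro signed_null_countable_Union[OF \<mu>])
      (auto intro!: countable_finite sets.Int intro: openin_sets_borel_of)
  then show ?thesis
    by (rule signed_null_subset) (use I \<open>K \<subseteq> L\<close> in auto)
qed

lemma signed_null_scattered_diff_atoms:
  assumes Y: "Hausdorff_space Y"
    and \<mu>: "finite_signed_measure (borel_of Y) \<mu>" and reg: "regular_signed_measure Y \<mu>"
    and E: "closedin Y E" and sc: "scattered_space (subtopology Y E)"
  shows "E - {x. \<mu> {x} \<noteq> 0} \<in> sets (borel_of Y)"
    and "signed_null (borel_of Y) \<mu> (E - {x. \<mu> {x} \<noteq> 0})"
proof -
  let ?D = "{x. \<mu> {x} \<noteq> 0}"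
  let ?null = "signed_null (borel_of Y) \<mu>"
  have sing: "{x} \<in> sets (borel_of Y)" if "x \<in> topspace Y" for x
    using closedin_sets_borel_of[OF closedin_Hausdorff_singleton[OF Y that]] .
  have sub: "x \<in> topspace Y" if "x \<in> ?D" for x
  proof -
    have "{x} \<in> sets (borel_of Y)"
      using that \<mu> unfolding finite_signed_measure_def by blast
    then show ?thesis
      using sets.sets_into_space by fastforce
  qed
  have "?D \<in> sets (borel_of Y)"
  proof (rule sets.countable)
    show "countable ?D"
      by (rule countable_atoms[OF \<mu>]) (simp add: sing)
  qed (rule sing[OF sub])
  then show ED: "E - ?D \<in> sets (borel_of Y)"
    using closedin_sets_borel_of[OF E] by auto
  show "?null (E - ?D)"
  proof (rule ccontr)
    assume "\<not> ?null (E - ?D)"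
    then obtain L where L: "compactin Y L" "L \<subseteq> E - ?D" "\<not> ?null L"
      using regular_signed_measure_not_null[OF reg Y ED] by blast
    have Ls: "L \<in> sets (borel_of Y)"
      by (rule closedin_sets_borel_of[OF compactin_imp_closedin[OF Y L(1)]])
    \<comment> \<open>\<open>F\<close> is the support of the variation of \<mu> on
      \<open>L\<close>.\<close>
    define F where "F = {x\<in>L. \<forall>U. openin Y U \<and> x \<in> U \<longrightarrow> \<not> ?null (U \<inter> L)}"
    have null_off_F: "?null C" if "compactin Y C" "C \<subseteq> L" "C \<inter> F = {}" for C
      using that by (intro compactin_signed_nullI[OF \<mu> _ _ _ Ls]) (auto simp: F_def)
    have "F \<noteq> {}"
      using null_off_F L by blast
    moreover have "F \<subseteq> topspace (subtopology Y E)"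
      using L E by (auto simp: F_def dest: closedin_subset compactin_subset_topspace)
    ultimately obtain x where x: "x \<in> F" "openin (subtopology (subtopology Y E) F) {x}"
      using sc unfolding scattered_space_def by blast
    moreover have "E \<inter> F = F"
      using L by (auto simp: F_def)
    ultimately obtain U where U: "openin Y U" "U \<inter> F = {x}"
      by (auto simp: subtopology_subtopology openin_subtopology)
    have xL: "x \<in> L" "\<not> ?null (U \<inter> L)"
      using x U by (auto simp: F_def)
    have xs: "{x} \<in> sets (borel_of Y)"
      using xL(1) sing compactin_subset_topspace[OF L(1)] by auto
    have ULs: "U \<inter> L - {x} \<in> sets (borel_of Y)"
      using openin_sets_borel_of[OF U(1)] Ls xs by auto
    \<comment> \<open>\<open>L\<close> avoids the atoms, so \<open>x\<close> carries no
      mass.\<close>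
    have "?null {x}"
      using xL L finite_signed_measure_empty[OF \<mu>] by (auto simp: signed_null_def subset_singleton_iff)
    moreover have "U \<inter> L \<subseteq> (U \<inter> L - {x}) \<union> {x}"
      by auto
    ultimately have "\<not> ?null (U \<inter> L - {x})"
      using xL(2) signed_null_Un[OF \<mu> ULs xs] signed_null_subset by metis
    \<comment> \<open>What remains after removing \<open>x\<close> is still non-null, so regularity
      puts a compact non-null set in it. As \<open>x\<close> is the only support point in
      \<open>U\<close>, that set misses \<open>F\<close> and must be null.\<close>
    then obtain C where C: "compactin Y C" "C \<subseteq> U \<inter> L - {x}" "\<not> ?null C"
      using regular_signed_measure_not_null[OF reg Y ULs] by blast
    then show False
      using null_off_F[of C] U by blast
  qed
qed

text \<open>For a positive measure every finite partition of a measurable set gives the same sum, so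
  the variation is the measure itself and regularity carries over.\<close>

lemma measure_regular_borel_measure:
  assumes "finite_measure M" and Y: "Hausdorff_space Y"
    and M: "sets M = sets (borel_of Y)" and reg: "regular_measure Y M"
  defines "\<mu> \<equiv> \<lambda>A. measure M A"
  shows "\<mu> \<in> regular_borel_measures Y"
    and "\<And>A. A \<in> sets M \<Longrightarrow> total_variation (borel_of Y) \<mu> A = emeasure M A"
proof -
  interpret finite_measure M by fact
  have fsm: "finite_signed_measure (borel_of Y) \<mu>"
    using finite_measure_UNION M by (auto simp: finite_signed_measure_def \<mu>_def measure_notin_sets)
  show tv: "total_variation (borel_of Y) \<mu> A = emeasure M A" if A: "A \<in> sets M" for A
  proof -
    have "(\<Sum>B\<in>P. ennreal \<bar>\<mu> B\<bar>) = emeasure M A"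
      if P: "finite P" "P \<subseteq> sets M" "disjoint P" "\<Union>P = A" for P
    proof -
      have "(\<Sum>B\<in>P. ennreal \<bar>\<mu> B\<bar>) = (\<Sum>B\<in>P. emeasure M B)"
        by (simp add: \<mu>_def emeasure_eq_measure)
      also have "\<dots> = emeasure M (\<Union>B\<in>P. B)"
        using P by (intro sum_emeasure) (auto simp: disjoint_family_on_def disjoint_def)
      finally show ?thesis
        using P by simp
    qed
    moreover have "{A} \<in> {P. finite P \<and> P \<subseteq> sets M \<and> disjoint P \<and> \<Union>P = A}"
      using A by (auto simp: disjoint_def)
    ultimately show ?thesis
      unfolding total_variation_def M[symmetric]
      by (intro antisym SUP_least SUP_upper2[of "{A}"])
        (auto simp: \<mu>_def emeasure_eq_measure)
  qed
  have op: "U \<in> sets M" if "openin Y U" for U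
    using that M openin_sets_borel_of by blast
  have cl: "K \<in> sets M" if "compactin Y K" for K
    unfolding M by (rule closedin_sets_borel_of[OF compactin_imp_closedin[OF Y that]])
  have "regular_signed_measure Y \<mu>"
    unfolding regular_signed_measure_def
  proof (intro ballI conjI)
    fix A assume "A \<in> sets (borel_of Y)"
    then have A: "A \<in> sets M"
      using M by simp
    show "total_variation (borel_of Y) \<mu> A =
        (INF U \<in> {U. openin Y U \<and> A \<subseteq> U}. total_variation (borel_of Y) \<mu> U)"
      using reg A unfolding tv[OF A] regular_measure_def
      by (metis (mono_tags, lifting) INF_cong mem_Collect_eq op tv)
    show "total_variation (borel_of Y) \<mu> A =
        (SUP K \<in> {K. compactin Y K \<and> K \<subseteq> A}. total_variation (borel_of Y) \<mu> K)"
      using reg A unfolding tv[OF A] regular_measure_def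
      by (metis (mono_tags, lifting) SUP_cong mem_Collect_eq cl tv)
  qed
  then show "\<mu> \<in> regular_borel_measures Y"
    using fsm by (simp add: regular_borel_measures_def)
qed

section \<open>Diffuse measures on non-scattered sets\<close>

text \<open>\<open>S\<close> has no isolated points, phrased through the open sets of
  \<open>Y\<close> so that every open set meeting \<open>S\<close> supplies two points to
  separate.\<close>

definition dense_in_itself :: "'a topology \<Rightarrow> 'a set \<Rightarrow> bool" where
  "dense_in_itself Y S \<longleftrightarrow> (\<forall>U. openin Y U \<longrightarrow> U \<inter> S \<noteq> {} \<longrightarrow> (\<exists>x\<in>U \<inter> S. \<exists>y\<in>U \<inter> S. x \<noteq> y))"

text \<open>Two points of \<open>S\<close> in \<open>U\<close> are separated by normality. The
  closures are kept disjoint because the cover of \<open>Y\<close> built from the tree is made of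
  complements of closures.\<close>

lemma dense_in_itself_split:
  assumes Y: "compact_space Y" "Hausdorff_space Y"
    and S: "S \<subseteq> topspace Y" "dense_in_itself Y S"
    and U: "openin Y U" "U \<inter> S \<noteq> {}"
  shows "\<exists>V :: bool \<Rightarrow> 'a set. (\<forall>b. openin Y (V b) \<and> V b \<inter> S \<noteq> {} \<and> V b \<subseteq> U) \<and>
           disjnt (Y closure_of V True) (Y closure_of V False)"
proof -
  obtain x y where xy: "x \<in> U \<inter> S" "y \<in> U \<inter> S" "x \<noteq> y"
    using S(2) U unfolding dense_in_itself_def by metis
  have "closedin Y {x}" "closedin Y {y}"
    using xy S(1) by (auto intro!: closedin_Hausdorff_singleton[OF Y(2)])
  moreover have "normal_space Y"
    using Y compact_Hausdorff_or_regular_imp_normal_space by blast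
  moreover have "disjnt {x} {y}"
    using xy by auto
  ultimately obtain A B where AB: "openin Y A" "openin Y B" "x \<in> A" "y \<in> B"
    "disjnt (Y closure_of A) (Y closure_of B)"
    unfolding normal_space_disjoint_closures by (metis insert_subset)
  let ?V = "\<lambda>b. if b then U \<inter> A else U \<inter> B"
  have "disjnt (Y closure_of (U \<inter> A)) (Y closure_of (U \<inter> B))"
    using AB(5) closure_of_mono[of "U \<inter> A" A Y] closure_of_mono[of "U \<inter> B" B Y]
    by (auto simp: disjnt_iff)
  then show ?thesis
    using xy AB U(1) by (intro exI[of _ ?V]) auto
qed

lemma dense_in_itself_tree:
  assumes Y: "compact_space Y" "Hausdorff_space Y"
    and S: "S \<subseteq> topspace Y" "S \<noteq> {}" "dense_in_itself Y S"
  obtains U :: "bool list \<Rightarrow> 'a set" where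
    "\<And>s. openin Y (U s)" "\<And>s. U s \<inter> S \<noteq> {}" "\<And>r s. U (r @ s) \<subseteq> U s"
    "\<And>s t. length s = length t \<Longrightarrow> s \<noteq> t \<Longrightarrow> disjnt (Y closure_of U s) (Y closure_of U t)"
proof -
  obtain V :: "'a set \<Rightarrow> bool \<Rightarrow> 'a set" where
    V: "\<And>U b. openin Y U \<Longrightarrow> U \<inter> S \<noteq> {} \<Longrightarrow> openin Y (V U b) \<and> V U b \<inter> S \<noteq> {} \<and> V U b \<subseteq> U"
    "\<And>U. openin Y U \<Longrightarrow> U \<inter> S \<noteq> {} \<Longrightarrow>
      disjnt (Y closure_of V U True) (Y closure_of V U False)"
    using dense_in_itself_split[OF Y S(1,3)] by metis
  \<comment> \<open>\<open>foldr\<close> uses the last entry of \<open>s\<close> first, so lists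
    grow at the head: the children of \<open>s\<close> are the lists \<open>b # s\<close>, and
    ancestors are suffixes.\<close>
  define U where "U s = foldr (\<lambda>b A. V A b) s (topspace Y)" for s
  have Cons: "U (b # s) = V (U s) b" for b s
    by (simp add: U_def)
  have U: "openin Y (U s) \<and> U s \<inter> S \<noteq> {}" for s
  proof (induction s)
    case Nil
    then show ?case
      using S by (auto simp: U_def)
  next
    case (Cons b s)
    then show ?case
      unfolding \<open>U (b # s) = V (U s) b\<close> using V(1) by blast
  qed
  have Cons_subset: "U (b # s) \<subseteq> U s" for b s
    unfolding Cons using V(1) U by blast
  have append: "U (r @ s) \<subseteq> U s" for r s
    by (induction r) (use Cons_subset in force)+
  have disj: "disjnt (Y closure_of U s) (Y closure_of U t)"
    if "length s = length t" "s \<noteq> t" for s t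
    using that
  proof (induction s t rule: list_induct2)
    case Nil
    then show ?case by simp
  next
    case (Cons a s b t)
    show ?case
    \<comment> \<open>Siblings are separated by the splitting; nodes with distinct parents inherit
      disjointness from these.\<close>
    proof (cases "s = t")
      case True
      have "disjnt (Y closure_of U (True # t)) (Y closure_of U (False # t))"
        unfolding \<open>\<And>b s. U (b # s) = V (U s) b\<close> using V(2) U by blast
      then show ?thesis
        using True Cons.prems by (cases a; cases b) (auto simp: disjnt_sym)
    next
      case False
      then have "disjnt (Y closure_of U s) (Y closure_of U t)"
        using Cons.IH by simp
      then show ?thesis
        using closure_of_mono[OF Cons_subset[of a s], of Y] closure_of_mono[OF Cons_subset[of b t], of Y]
        by (auto simp: disjnt_iff)
    qed
  qed
  show thesis
    by (rule that[of U]) (use U append disj in auto)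
qed

lemma card_bool_lists: "card {t :: bool list. length t = n} = 2 ^ n"
  using card_lists_length_eq[of "UNIV :: bool set" n] by simp

lemma finite_bool_lists: "finite {t :: bool list. length t = n}"
  using finite_lists_length_eq[of "UNIV :: bool set" n] by simp

text \<open>Tychonoff's theorem, since the topology of the function type is the product
  topology.\<close>

lemma compact_unit_functionals: "compact {m :: 'b \<Rightarrow> real. \<forall>A. 0 \<le> m A \<and> m A \<le> 1}"
proof -
  have "compactin (product_topology (\<lambda>i::'b. euclidean) UNIV) (PiE UNIV (\<lambda>_. {0..1::real}))"
    by (simp add: compactin_PiE)
  moreover have "PiE UNIV (\<lambda>_. {0..1::real}) = {m :: 'b \<Rightarrow> real. \<forall>A. 0 \<le> m A \<and> m A \<le> 1}"
    by (auto simp: PiE_def Pi_def)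
  ultimately show ?thesis
    by (simp add: euclidean_product_topology)
qed

text \<open>The charge is a cluster point of the uniform distributions on points chosen in the
  \<open>2\<^sup>n\<close> nodes of level \<open>n\<close> of the tree.\<close>

lemma dense_in_itself_charge:
  assumes Y: "compact_space Y" "Hausdorff_space Y"
    and S: "S \<subseteq> topspace Y" "S \<noteq> {}" "dense_in_itself Y S"
  obtains m :: "'a set \<Rightarrow> real" where
    "\<And>A. 0 \<le> m A" "\<And>A B. A \<inter> B = {} \<Longrightarrow> m (A \<union> B) = m A + m B"
    "m S = 1" "m (- S) = 0"
    "\<And>x n. x \<in> topspace Y \<Longrightarrow> \<exists>U. openin Y U \<and> x \<in> U \<and> m U \<le> (1/2) ^ n"
proof -
  obtain U :: "bool list \<Rightarrow> 'a set" where U: "\<And>s. openin Y (U s)" "\<And>s. U s \<inter> S \<noteq> {}"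
    "\<And>r s. U (r @ s) \<subseteq> U s"
    "\<And>s t. length s = length t \<Longrightarrow> s \<noteq> t \<Longrightarrow> disjnt (Y closure_of U s) (Y closure_of U t)"
    by (rule dense_in_itself_tree[OF Y S]) (rule that)
  define p where "p s = (SOME y. y \<in> U s \<inter> S)" for s
  have "p s \<in> U s \<inter> S" for s
    unfolding p_def by (rule someI_ex) (use U(2)[of s] in blast)
  then have p: "\<And>s. p s \<in> U s" "\<And>s. p s \<in> S"
    by auto
  \<comment> \<open>Removing the closures of all other nodes of the same level leaves an open set
    that meets only one node of that level. Disjointness of the closures makes these sets cover
    \<open>Y\<close>.\<close>
  define W where "W s = topspace Y - (\<Union>t\<in>{t. length t = length s} - {s}. Y closure_of U t)" for s
  have W_open: "openin Y (W s)" for s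
    unfolding W_def by (intro openin_diff openin_topspace closedin_Union) (auto simp: finite_bool_lists)
  have W_cover: "\<exists>s. length s = n \<and> x \<in> W s" if "x \<in> topspace Y" for x n
  proof (cases "\<exists>s. length s = n \<and> x \<in> Y closure_of U s")
    case True
    then obtain s where s: "length s = n" "x \<in> Y closure_of U s" by blast
    then have "x \<in> W s"
      using that U(4) by (auto simp: W_def disjnt_iff)
    then show ?thesis
      using s by blast
  next
    case False
    then show ?thesis
      using that by (intro exI[of _ "replicate n True"]) (auto simp: W_def)
  qed
  \<comment> \<open>Indices are counted rather than points, so the total mass is 1 by counting
    lists.\<close>
  define avg where "avg n A = card {t. length t = n \<and> p t \<in> A} / 2 ^ n" for n A
  have fin: "finite {t. length t = n \<and> p t \<in> A}" for n A
    using finite_bool_lists[of n] by (rule rev_finite_subset) auto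
  \<comment> \<open>Additivity in this form is an equation between coordinates for all
    \<open>A\<close> and \<open>B\<close>, which defines a closed set of functionals.\<close>
  have avg_Un: "avg n (A \<union> B) = avg n A + avg n (B - A)" for n A B
  proof -
    have "card {t. length t = n \<and> p t \<in> A \<union> B} =
        card ({t. length t = n \<and> p t \<in> A} \<union> {t. length t = n \<and> p t \<in> B - A})"
      by (rule arg_cong[where f = card]) auto
    also have "\<dots> = card {t. length t = n \<and> p t \<in> A} + card {t. length t = n \<and> p t \<in> B - A}"
      by (intro card_Un_disjoint fin) auto
    finally show ?thesis
      unfolding avg_def by (simp only: of_nat_add add_divide_distrib)
  qed
  have avg_S: "avg n S = 1" "avg n (- S) = 0" for n
    using p(2) by (auto simp: avg_def card_bool_lists)
  have avg_bounds: "0 \<le> avg n A \<and> avg n A \<le> 1" for n A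
  proof -
    have "card {t. length t = n \<and> p t \<in> A} \<le> card {t :: bool list. length t = n}"
      by (intro card_mono finite_bool_lists) auto
    then show ?thesis
      by (simp add: avg_def card_bool_lists)
  qed
  \<comment> \<open>If \<open>p t\<close> lies in \<open>W s\<close>, the ancestor of
    \<open>t\<close> at the level of \<open>s\<close> must be \<open>s\<close> itself, which leaves
    at most \<open>2 ^ (n - length s)\<close> of the \<open>2 ^ n\<close> indices.\<close>
  have avg_W: "avg n (W s) \<le> (1/2) ^ length s" if n: "length s \<le> n" for n s
  proof -
    let ?k = "n - length s"
    have "{t. length t = n \<and> p t \<in> W s} \<subseteq> (\<lambda>r. r @ s) ` {r. length r = ?k}"
    proof clarify
      fix t assume t: "n = length t" "p t \<in> W s"
      let ?s = "drop (length t - length s) t"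
      have "p t \<in> U ?s"
        using p(1)[of t] U(3)[of "take (length t - length s) t" ?s] by auto
      then have "p t \<in> Y closure_of U ?s"
        using closure_of_subset[OF openin_subset[OF U(1)]] by blast
      moreover have "length ?s = length s"
        using t n by simp
      ultimately have "?s = s"
        using t by (auto simp: W_def)
      then show "t \<in> (\<lambda>r. r @ s) ` {r. length r = length t - length s}"
        using append_take_drop_id[of "length t - length s" t]
        by (intro image_eqI[of _ _ "take (length t - length s) t"]) auto
    qed
    then have "card {t. length t = n \<and> p t \<in> W s} \<le> card ((\<lambda>r. r @ s) ` {r. length r = ?k})"
      by (intro card_mono finite_imageI finite_bool_lists)
    also have "\<dots> \<le> 2 ^ ?k"
      using card_image_le[OF finite_bool_lists, of "\<lambda>r. r @ s" ?k] by (simp add: card_bool_lists)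
    finally have "real (card {t. length t = n \<and> p t \<in> W s}) \<le> 2 ^ ?k"
      by (metis of_nat_le_iff of_nat_numeral of_nat_power)
    moreover have "(2::real) ^ n = 2 ^ ?k * 2 ^ length s"
      using n by (simp flip: power_add)
    ultimately show ?thesis
      by (simp add: avg_def field_simps power_divide)
  qed
  let ?P = "{m :: 'a set \<Rightarrow> real. \<forall>A. 0 \<le> m A \<and> m A \<le> 1}"
  let ?K = "\<lambda>s. {m :: 'a set \<Rightarrow> real. (\<forall>A B. m (A \<union> B) = m A + m (B - A)) \<and>
    m S = 1 \<and> m (- S) = 0 \<and> m (W s) \<le> (1/2) ^ length s}"
  have "?P \<inter> (\<Inter>s\<in>UNIV. ?K s) \<noteq> {}"
  proof (rule compact_imp_fip_image[OF compact_unit_functionals])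
    show "closed (?K s)" for s
      by (intro closed_Collect_conj closed_Collect_all closed_Collect_eq closed_Collect_le
          continuous_intros continuous_on_product_coordinates)
    show "?P \<inter> (\<Inter>s\<in>I. ?K s) \<noteq> {}" if I: "finite I" for I
    proof -
      \<comment> \<open>A single average at a level at least as deep as every list in
        \<open>I\<close> meets all selected conditions, as the finite intersection property
        requires.\<close>
      obtain n where n: "\<And>s. s \<in> I \<Longrightarrow> length s \<le> n"
        using I by (metis finite_imageI finite_nat_set_iff_bounded_le imageI)
      have "avg n \<in> ?P \<inter> (\<Inter>s\<in>I. ?K s)"
        using avg_bounds avg_Un avg_S avg_W n by blast
      then show ?thesis by blast
    qed
  qed
  then obtain m where mem: "m \<in> ?P \<inter> (\<Inter>s\<in>UNIV. ?K s)"
    by (meson ex_in_conv)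
  have m: "\<And>A. 0 \<le> m A" "\<And>A B. m (A \<union> B) = m A + m (B - A)"
    "m S = 1" "m (- S) = 0" "\<And>s. m (W s) \<le> (1/2) ^ length s"
    using mem by blast+
  show thesis
  proof (rule that[of m])
    show "m (A \<union> B) = m A + m B" if "A \<inter> B = {}" for A B
      using m(2)[of A B] that by (simp add: Diff_triv Int_commute)
    show "\<exists>V. openin Y V \<and> x \<in> V \<and> m V \<le> (1/2) ^ n" if "x \<in> topspace Y" for x n
      using W_cover[OF that, of n] W_open m(5) by metis
  qed (use m in auto)
qed

lemma not_scattered_dense_in_itself:
  assumes "\<not> scattered_space (subtopology Y E)" "E \<subseteq> topspace Y"
  obtains S where "S \<subseteq> E" "S \<noteq> {}" "dense_in_itself Y S"
proof -
  obtain S where S: "S \<subseteq> topspace (subtopology Y E)" "S \<noteq> {}"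
    "\<And>x. x \<in> S \<Longrightarrow> \<not> openin (subtopology (subtopology Y E) S) {x}"
    using assms unfolding scattered_space_def by blast
  have SE: "S \<subseteq> E"
    using S(1) by simp
  have iso: "\<not> openin (subtopology Y S) {x}" if "x \<in> S" for x
    using that SE S(3)[OF that] by (simp add: subtopology_subtopology inf.absorb2)
  have "dense_in_itself Y S"
    unfolding dense_in_itself_def
  proof (intro allI impI, rule ccontr)
    fix U assume U: "openin Y U" "U \<inter> S \<noteq> {}" "\<not> (\<exists>x\<in>U \<inter> S. \<exists>y\<in>U \<inter> S. x \<noteq> y)"
    then obtain x where "U \<inter> S = {x}"
      by blast
    then show False
      using U(1) iso[of x] by (metis IntD2 insertI1 openin_subtopology)
  qed
  then show thesis
    using that SE S(2) by blast
qed

text \<open>The charge lives on \<open>S\<close>, which may fail to be Borel; the measure is shown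
  to live on the closed set \<open>E\<close>, whose complement is open and has charge 0. Points are
  null because they have open neighbourhoods of arbitrarily small charge.\<close>

lemma not_scattered_diffuse_measure:
  assumes Y: "compact_space Y" "Hausdorff_space Y"
    and E: "closedin Y E" and ns: "\<not> scattered_space (subtopology Y E)"
  obtains M where "finite_measure M" "sets M = sets (borel_of Y)" "regular_measure Y M"
    "emeasure M (topspace Y - E) = 0" "emeasure M (topspace Y) = 1"
    "\<And>x. x \<in> topspace Y \<Longrightarrow> emeasure M {x} = 0"
proof -
  have EY: "E \<subseteq> topspace Y"
    using E closedin_subset by blast
  obtain S where S: "S \<subseteq> E" "S \<noteq> {}" "dense_in_itself Y S"
    by (rule not_scattered_dense_in_itself[OF ns EY])
  have SY: "S \<subseteq> topspace Y"
    using S EY by blast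
  obtain m :: "'a set \<Rightarrow> real" where m: "\<And>A. 0 \<le> m A" "\<And>A B. A \<inter> B = {} \<Longrightarrow> m (A \<union> B) = m A + m B"
    "m S = 1" "m (- S) = 0"
    "\<And>x n. x \<in> topspace Y \<Longrightarrow> \<exists>U. openin Y U \<and> x \<in> U \<and> m U \<le> (1/2) ^ n"
    by (rule dense_in_itself_charge[OF Y SY S(2,3)]) (rule that)
  interpret compact_Hausdorff_charge Y m
    by unfold_locales (use Y m in auto)
  have off: "m A = 0" if "A \<inter> S = {}" for A
    using charge_mono[of A "- S"] that m(1)[of A] m(4) by auto
  show thesis
  proof (rule that[OF finite_charge_measure sets_charge_measure regular_charge_measure])
    have "openin Y (topspace Y - E)"
      using E by blast
    then show "emeasure charge_measure (topspace Y - E) = 0"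
      using emeasure_charge_measure_open_le[of "topspace Y - E"] off[of "topspace Y - E"] S(1)
      by (simp add: Diff_Int_distrib2 Int_Diff disjoint_iff subset_iff)
    have "m (topspace Y) = m S + m (topspace Y - S)"
      using m(2)[of S "topspace Y - S"] SY by (simp add: Un_absorb1)
    then show "emeasure charge_measure (topspace Y) = 1"
      using off[of "topspace Y - S"] m(3) by (simp add: emeasure_charge_measure_space Diff_Int_distrib2)
  next
    fix x assume x: "x \<in> topspace Y"
    have "emeasure charge_measure {x} \<le> ennreal ((1/2) ^ n)" for n
    proof -
      obtain U where U: "openin Y U" "x \<in> U" "m U \<le> (1/2) ^ n"
        using m(5)[OF x] by blast
      have "emeasure charge_measure {x} \<le> emeasure charge_measure U"
        using U openin_sets_borel_of by (intro emeasure_mono) auto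
      also have "\<dots> \<le> ennreal (m U)"
        using U emeasure_charge_measure_open_le by blast
      also have "\<dots> \<le> ennreal ((1/2) ^ n)"
        using U by (intro ennreal_leI)
      finally show ?thesis .
    qed
    moreover have "(\<lambda>n. ennreal ((1/2) ^ n)) \<longlonglongrightarrow> ennreal 0"
      by (intro tendsto_ennrealI LIMSEQ_realpow_zero) auto
    ultimately have "emeasure charge_measure {x} \<le> ennreal 0"
      by (intro LIMSEQ_le_const) auto
    then show "emeasure charge_measure {x} = 0"
      by simp
  qed
qed

section \<open>Scatteredness under homeomorphisms and embeddings\<close>

lemma scattered_space_homeomorphic_map:
  assumes f: "homeomorphic_map X Y f" and X: "scattered_space X"
  shows "scattered_space Y"
  unfolding scattered_space_def
proof (intro allI impI)
  fix T assume T: "T \<subseteq> topspace Y" "T \<noteq> {}"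
  let ?S = "{x \<in> topspace X. f x \<in> T}"
  have fS: "f ` ?S = T"
    using T homeomorphic_imp_surjective_map[OF f] by auto
  then have "?S \<noteq> {}"
    using T by auto
  then obtain x where x: "x \<in> ?S" "openin (subtopology X ?S) {x}"
    using X unfolding scattered_space_def by (metis (no_types, lifting) mem_Collect_eq subsetI)
  have "homeomorphic_map (subtopology X ?S) (subtopology Y T) f"
    by (rule homeomorphic_map_subtopologies[OF f]) (use T homeomorphic_imp_surjective_map[OF f] in auto)
  then have "openin (subtopology Y T) (f ` {x})"
    using x by (subst homeomorphic_map_openness) auto
  then show "\<exists>y\<in>T. openin (subtopology Y T) {y}"
    using x by auto
qed

lemma scattered_space_embedding:
  assumes f: "embedding_map X Y f" and K: "K \<subseteq> topspace X"
  shows "scattered_space (subtopology Y (f ` K)) \<longleftrightarrow> scattered_space (subtopology X K)"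
proof -
  have "homeomorphic_map (subtopology X K) (subtopology (subtopology Y (f ` topspace X)) (f ` K)) f"
  proof (rule homeomorphic_map_subtopologies)
    show "homeomorphic_map X (subtopology Y (f ` topspace X)) f"
      using f by (simp add: embedding_map_def)
    then have "topspace (subtopology Y (f ` topspace X)) = f ` topspace X"
      by (rule homeomorphic_imp_surjective_map[symmetric])
    then show "f ` (topspace X \<inter> K) = topspace (subtopology Y (f ` topspace X)) \<inter> f ` K"
      using K by (simp add: inf.absorb2 image_mono)
  qed
  moreover have "subtopology (subtopology Y (f ` topspace X)) (f ` K) = subtopology Y (f ` K)"
    using K by (simp add: subtopology_subtopology inf.absorb2 image_mono)
  ultimately have h: "homeomorphic_map (subtopology X K) (subtopology Y (f ` K)) f"
    by simp
  then obtain g where "homeomorphic_map (subtopology Y (f ` K)) (subtopology X K) g"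
    by (metis homeomorphic_map_maps homeomorphic_maps_sym)
  then show ?thesis
    using scattered_space_homeomorphic_map[OF h] scattered_space_homeomorphic_map by metis
qed

section \<open>Measures on the Stone--Cech compactification\<close>

lemma M_d_subset_M_R: "M_d X \<subseteq> M_R X"
proof
  fix \<mu> assume "\<mu> \<in> M_d X"
  then obtain S where \<mu>: "\<mu> \<in> regular_borel_measures (stone_cech X)"
    and S: "S \<subseteq> topspace X" "countable S"
    and conc: "concentrated_on (stone_cech X) \<mu> (stone_cech_embed X ` S)"
    by (auto simp: M_d_def)
  have "(countable union_of compactin X) S"
    unfolding union_of_def
    \<comment> \<open>A countable set is the countable union of its singletons, which are
      compact.\<close>
    using S by (intro exI[of _ "(\<lambda>x. {x}) ` S"]) auto
  then show "\<mu> \<in> M_R X"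
    using \<mu> conc by (auto simp: M_R_def)
qed

lemma closedin_stone_cech_embed_image:
  assumes "completely_regular_space X" "Hausdorff_space X" "compactin X K"
  shows "closedin (stone_cech X) (stone_cech_embed X ` K)"
proof (rule compactin_imp_closedin[OF Hausdorff_space_stone_cech])
  have "continuous_map X (stone_cech X) (stone_cech_embed X)"
    using homeomorphic_imp_continuous_map[OF
        embedding_map_stone_cech[OF assms(1,2), unfolded embedding_map_def]]
    by (simp add: continuous_map_in_subtopology)
  with assms(3) show "compactin (stone_cech X) (stone_cech_embed X ` K)"
    by (rule image_compactin)
qed

text \<open>Each compact piece of \<open>S\<close> embeds as a closed scattered set, which is null
  apart from atoms. Countably many pieces leave \<mu> concentrated on the atoms in the image of
  \<open>S\<close>.\<close>

lemma M_R_subset_M_d: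
  assumes X: "completely_regular_space X" "Hausdorff_space X"
    and sc: "\<And>K. compactin X K \<Longrightarrow> scattered_space (subtopology X K)"
  shows "M_R X \<subseteq> M_d X"
proof
  let ?Y = "stone_cech X" and ?e = "stone_cech_embed X"
  let ?B = "borel_of ?Y"
  fix \<mu> assume "\<mu> \<in> M_R X"
  then obtain S where \<mu>: "\<mu> \<in> regular_borel_measures ?Y"
    and S: "(countable union_of compactin X) S" and conc: "concentrated_on ?Y \<mu> (?e ` S)"
    by (auto simp: M_R_def)
  have fsm: "finite_signed_measure ?B \<mu>" and reg: "regular_signed_measure ?Y \<mu>"
    using \<mu> by (auto simp: regular_borel_measures_def)
  obtain \<K> where \<K>: "countable \<K>" "\<And>K. K \<in> \<K> \<Longrightarrow> compactin X K" "\<Union>\<K> = S"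
    using S unfolding union_of_def by auto
  have SX: "S \<subseteq> topspace X"
    using \<K> compactin_subset_topspace by blast
  define D where "D = {y. \<mu> {y} \<noteq> 0}"
  have part: "?e ` K - D \<in> sets ?B" "signed_null ?B \<mu> (?e ` K - D)" if "K \<in> \<K>" for K
  proof -
    have K: "compactin X K"
      using \<K> that by blast
    have "scattered_space (subtopology ?Y (?e ` K))"
      using scattered_space_embedding[OF embedding_map_stone_cech[OF X] compactin_subset_topspace[OF K]]
        sc[OF K] by simp
    then show "?e ` K - D \<in> sets ?B" "signed_null ?B \<mu> (?e ` K - D)"
      unfolding D_def
      using signed_null_scattered_diff_atoms[OF Hausdorff_space_stone_cech fsm reg
          closedin_stone_cech_embed_image[OF X K]] by auto
  qed
  have "?e ` K \<in> sets ?B" if "K \<in> \<K>" for K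
    by (intro closedin_sets_borel_of closedin_stone_cech_embed_image[OF X] \<K>(2) that)
  then have "(\<Union>K\<in>\<K>. ?e ` K) \<in> sets ?B"
    using \<K>(1) by (intro sets.countable_UN'') auto
  moreover have "(\<Union>K\<in>\<K>. ?e ` K) = ?e ` S"
    using \<K>(3) by blast
  ultimately have off: "topspace ?Y - ?e ` S \<in> sets ?B"
    using sets.compl_sets[of "?e ` S" ?B] by simp
  then have off_null: "signed_null ?B \<mu> (topspace ?Y - ?e ` S)"
    using conc total_variation_eq_0_iff[OF off] by (simp add: concentrated_on_def)
  \<comment> \<open>These null Borel sets have exactly the complement of the image of
    \<open>T\<close> as their union. Equality makes that complement Borel, as passing from nullity
    to variation zero requires.\<close>
  let ?\<A> = "insert (topspace ?Y - ?e ` S) ((\<lambda>K. ?e ` K - D) ` \<K>)"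
  have \<A>: "countable ?\<A>" "?\<A> \<subseteq> sets ?B"
    using \<K>(1) off part by auto
  have "signed_null ?B \<mu> (\<Union>?\<A>)"
    using off_null part by (intro signed_null_countable_Union[OF fsm \<A>]) auto
  \<comment> \<open>The points of \<open>S\<close> lying over atoms; they are countably many because
    the atoms are and the embedding is injective.\<close>
  moreover define T where "T = {x \<in> S. ?e x \<in> D}"
  have "topspace ?Y - ?e ` T = \<Union>?\<A>"
    using SX stone_cech_embed_image_subset[of X] \<K>(3) by (auto simp: T_def)
  moreover have "\<Union>?\<A> \<in> sets ?B"
    using \<A> by (intro sets.countable_Union)
  ultimately have "concentrated_on ?Y \<mu> (?e ` T)"
    by (simp add: concentrated_on_def total_variation_eq_0_iff)
  moreover have "countable T"
  proof (rule countable_image_inj_on)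
    have sing: "{y} \<in> sets ?B" if "y \<in> space ?B" for y
      using that by (intro closedin_sets_borel_of closedin_Hausdorff_singleton Hausdorff_space_stone_cech) simp
    have "countable D"
      unfolding D_def by (rule countable_atoms[OF fsm sing])
    then show "countable (?e ` T)"
      by (rule countable_subset[rotated]) (auto simp: T_def)
    have "inj_on ?e (topspace X)"
      using embedding_map_stone_cech[OF X] homeomorphic_imp_injective_map
      unfolding embedding_map_def by blast
    then show "inj_on ?e T"
      by (rule inj_on_subset) (use SX in \<open>auto simp: T_def\<close>)
  qed
  moreover have "T \<subseteq> topspace X"
    using SX by (auto simp: T_def)
  ultimately show "\<mu> \<in> M_d X"
    using \<mu> by (auto simp: M_d_def)
qed

text \<open>A diffuse probability on the image of \<open>K\<close> belongs to \<open>M_R X\<close>,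
  with \<open>K\<close> as the sigma-compact set. Countable sets are null for it, so concentration
  on one would make its total mass 0.\<close>

lemma M_R_diff_M_d:
  assumes X: "completely_regular_space X" "Hausdorff_space X"
    and K: "compactin X K" "\<not> scattered_space (subtopology X K)"
  shows "\<exists>\<mu>. \<mu> \<in> M_R X \<and> \<mu> \<notin> M_d X"
proof -
  let ?Y = "stone_cech X" and ?e = "stone_cech_embed X"
  have cl: "closedin ?Y (?e ` K)"
    by (rule closedin_stone_cech_embed_image[OF X K(1)])
  have "\<not> scattered_space (subtopology ?Y (?e ` K))"
    using scattered_space_embedding[OF embedding_map_stone_cech[OF X] compactin_subset_topspace[OF K(1)]]
      K(2) by simp
  then obtain M where M: "finite_measure M" "sets M = sets (borel_of ?Y)" "regular_measure ?Y M"
    "emeasure M (topspace ?Y - ?e ` K) = 0" "emeasure M (topspace ?Y) = 1"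
    "\<And>y. y \<in> topspace ?Y \<Longrightarrow> emeasure M {y} = 0"
    using not_scattered_diffuse_measure[OF compact_space_stone_cech Hausdorff_space_stone_cech cl]
    by metis
  let ?\<mu> = "\<lambda>A. measure M A"
  note \<mu> = measure_regular_borel_measure[OF M(1) Hausdorff_space_stone_cech M(2,3)]
  have top: "topspace ?Y \<in> sets M"
    using M(2) by (simp add: openin_sets_borel_of)
  have "(countable union_of compactin X) K"
    unfolding union_of_def using K(1) by (intro exI[of _ "{K}"]) auto
  moreover have "concentrated_on ?Y ?\<mu> (?e ` K)"
    unfolding concentrated_on_def
    using M(2,4) \<mu>(2)[of "topspace ?Y - ?e ` K"] top closedin_sets_borel_of[OF cl] by simp
  ultimately have "?\<mu> \<in> M_R X"
    using \<mu>(1) by (auto simp: M_R_def)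
  moreover have "?\<mu> \<notin> M_d X"
  proof
    assume "?\<mu> \<in> M_d X"
    then obtain S where S: "S \<subseteq> topspace X" "countable S" "concentrated_on ?Y ?\<mu> (?e ` S)"
      by (auto simp: M_d_def)
    have eS: "?e ` S \<subseteq> topspace ?Y" "countable (?e ` S)"
      using S stone_cech_embed_image_subset[of X] by auto
    have sing: "{y} \<in> sets M" if "y \<in> ?e ` S" for y
      unfolding M(2) using that eS
      by (intro closedin_sets_borel_of closedin_Hausdorff_singleton Hausdorff_space_stone_cech) auto
    have eSM: "?e ` S \<in> sets M"
      by (rule sets.countable[OF sing eS(2)])
    have null: "?e ` S \<in> null_sets M"
    proof -
      have "(\<Union>y\<in>?e ` S. {y}) \<in> null_sets M"
        using sing M(6) eS by (intro null_sets_UN' eS(2)) (auto simp: null_sets_def)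
      then show ?thesis by simp
    qed
    have "emeasure M (topspace ?Y - ?e ` S) = 0"
      using S(3) \<mu>(2)[of "topspace ?Y - ?e ` S"] top eSM by (simp add: concentrated_on_def)
    then have "emeasure M (topspace ?Y) = 0"
      using emeasure_Diff_null_set[OF null top] by simp
    then show False
      using M(5) by simp
  qed
  ultimately show ?thesis by blast
qed

theorem proposition1:
  fixes X :: "'a topology"
  assumes "completely_regular_space X" and "Hausdorff_space X"
  shows "universally_R_measure_zero X \<longleftrightarrow>
         (\<forall>K. compactin X K \<longrightarrow> scattered_space (subtopology X K))"
  unfolding universally_R_measure_zero_def
  using M_d_subset_M_R M_R_subset_M_d[OF assms] M_R_diff_M_d[OF assms] by blast

end
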